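(* Let $B=\operatorname{diag}(-1,1)$, $Q=\begin{pmatrix}0&Q_{12}\\ Q_{21}&0\end{pmatrix}\in L^2([0,1];\mathbb{C}^{2\times2})$, and consider the problem $$-iBy'+Q(x)y=\lambda y,\qquad a_{j1}y_1(0)+a_{j2}y_2(0)+a_{j3}y_1(1)+a_{j4}y_2(1)=0,\quad j\in\{1,2\}.$$ Put $J_{jk}=\det\begin{pmatrix}a_{1j}&a_{1k}\\ a_{2j}&a_{2k}\end{pmatrix}$, $j,k\in\{1,\dots,4\}$. Assume that $J_{14}=J_{32}=0$ but $J_{13}J_{42}\neq0$. Further, let $0\notin\operatorname{supp}P_1\cup\operatorname{supp}P_2$, where $$P_1(x):=J_{13}Q_{12}(x)-J_{42}Q_{21}(1-x),\qquad P_2(x):=J_{13}Q_{12}(1-x)-J_{42}Q_{21}(x),\qquad x\in[0,1].$$ Then the defect of the system of root functions of this problem in $L^2([0,1];\mathbb{C}^2)$ is infinite.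
   Context: The $a_{jk}$ are complex numbers, $y=\operatorname{col}(y_1,y_2)$. The problem is identified with the operator $L$ in $L^2([0,1];\mathbb{C}^2)$ acting by $Ly=-iBy'+Q(x)y$ on the set of $y\in W^1_2([0,1];\mathbb{C}^2)$ satisfying the two boundary conditions. $\operatorname{supp}$ denotes the (closed, essential) support in $[0,1]$. Root functions are eigenfunctions and associated functions, i.e. the system of root functions is the union, over all eigenvalues $\lambda$, of bases of the root subspaces $\operatorname{span}\{\ker(L-\lambda)^k: k\in\mathbb{N}\}$. The defect of a system is the dimension of the orthogonal complement of its closed linear span. *)

theory Defs
  imports "HOL-Analysis.Analysis" "HOL-Library.Extended_Nat"
begin

text \<open>
  An element of $L^2([0,1];E)$ is represented by any of its representatives, a total function on
  the reals; its values outside $[0,1]$ are irrelevant. All notions below that concern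
  $L^2$ are invariant under changing functions on a null subset of $[0,1]$ (relation \<open>eq01\<close>).
\<close>

abbreviation M01 :: "real measure" where
  "M01 \<equiv> lebesgue_on {0..1}"

definition eq01 :: "(real \<Rightarrow> 'a) \<Rightarrow> (real \<Rightarrow> 'a) \<Rightarrow> bool" where
  "eq01 f g \<longleftrightarrow> (AE x in M01. f x = g x)"

definition L2 :: "(real \<Rightarrow> 'a::euclidean_space) set" where
  "L2 = {f. f \<in> borel_measurable M01 \<and> integrable M01 (\<lambda>x. (norm (f x))\<^sup>2)}"

definition L2_norm :: "(real \<Rightarrow> 'a::euclidean_space) \<Rightarrow> real" where
  "L2_norm f = sqrt (LINT x|M01. (norm (f x))\<^sup>2)"

definition L2_inner :: "(real \<Rightarrow> complex^2) \<Rightarrow> (real \<Rightarrow> complex^2) \<Rightarrow> complex" where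
  "L2_inner f g = (LINT x|M01. (\<Sum>j\<in>UNIV. f x $ j * cnj (g x $ j)))"

definition lin_comb ::
  "(real \<Rightarrow> complex^2) set \<Rightarrow> ((real \<Rightarrow> complex^2) \<Rightarrow> complex) \<Rightarrow> real \<Rightarrow> complex^2" where
  "lin_comb F c = (\<lambda>x. \<Sum>f\<in>F. c f *s f x)"

definition L2_span :: "(real \<Rightarrow> complex^2) set \<Rightarrow> (real \<Rightarrow> complex^2) set" where
  "L2_span S = {g \<in> L2. \<exists>F c. finite F \<and> F \<subseteq> S \<and> eq01 g (lin_comb F c)}"

definition L2_indep :: "(real \<Rightarrow> complex^2) set \<Rightarrow> bool" where
  "L2_indep S \<longleftrightarrow>
     (\<forall>F c. finite F \<and> F \<subseteq> S \<and> eq01 (lin_comb F c) (\<lambda>_. 0) \<longrightarrow> (\<forall>f\<in>F. c f = 0))"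

definition L2_basis :: "(real \<Rightarrow> complex^2) set \<Rightarrow> (real \<Rightarrow> complex^2) set \<Rightarrow> bool" where
  "L2_basis b V \<longleftrightarrow> b \<subseteq> V \<and> L2_indep b \<and> V \<subseteq> L2_span b"

definition L2_dim :: "(real \<Rightarrow> complex^2) set \<Rightarrow> enat" where
  "L2_dim V = Sup {enat (card F) | F. finite F \<and> F \<subseteq> V \<and> L2_indep F}"

definition L2_closure :: "(real \<Rightarrow> complex^2) set \<Rightarrow> (real \<Rightarrow> complex^2) set" where
  "L2_closure A = {g \<in> L2. \<forall>e>0. \<exists>f\<in>A. L2_norm (\<lambda>x. g x - f x) < e}"

definition L2_orth_compl :: "(real \<Rightarrow> complex^2) set \<Rightarrow> (real \<Rightarrow> complex^2) set" where
  "L2_orth_compl A = {g \<in> L2. \<forall>f\<in>A. L2_inner g f = 0}"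

definition defect :: "(real \<Rightarrow> complex^2) set \<Rightarrow> enat" where
  "defect S = L2_dim (L2_orth_compl (L2_closure (L2_span S)))"

text \<open>
  \<open>W12_deriv u g\<close>: the function \<open>u\<close> is (on $[0,1]$) the absolutely continuous
  representative of an element of $W^1_2([0,1];\mathbb{C}^2)$, and \<open>g\<close> is its derivative.
\<close>

definition W12_deriv :: "(real \<Rightarrow> complex^2) \<Rightarrow> (real \<Rightarrow> complex^2) \<Rightarrow> bool" where
  "W12_deriv u g \<longleftrightarrow>
     g \<in> L2 \<and> (\<forall>x\<in>{0..1}. u x = u 0 + (LINT t|lebesgue_on {0..x}. g t))"

definition boundary_conditions :: "complex^4^2 \<Rightarrow> (real \<Rightarrow> complex^2) \<Rightarrow> bool" where
  "boundary_conditions a u \<longleftrightarrow>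
     (\<forall>j. a$j$1 * u 0 $ 1 + a$j$2 * u 0 $ 2 + a$j$3 * u 1 $ 1 + a$j$4 * u 1 $ 2 = 0)"

text \<open>
  The operator $Ly = -iBy' + Qy$ in $L^2$ as a graph, closed under a.e. equality in both
  arguments. The boundary values are those of the absolutely continuous representative \<open>u\<close>.
\<close>

definition dirac_op ::
  "complex^2^2 \<Rightarrow> (real \<Rightarrow> complex^2^2) \<Rightarrow> complex^4^2
    \<Rightarrow> ((real \<Rightarrow> complex^2) \<times> (real \<Rightarrow> complex^2)) set" where
  "dirac_op B Q a = {(y, f). y \<in> L2 \<and> f \<in> L2 \<and>
     (\<exists>u g. eq01 y u \<and> W12_deriv u g \<and> boundary_conditions a u \<and>
        eq01 f (\<lambda>x. (- \<i>) *s (B *v g x) + Q x *v u x))}"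

definition is_eigenvalue ::
  "((real \<Rightarrow> complex^2) \<times> (real \<Rightarrow> complex^2)) set \<Rightarrow> complex \<Rightarrow> bool" where
  "is_eigenvalue L l \<longleftrightarrow>
     (\<exists>y. \<not> eq01 y (\<lambda>_. 0) \<and> (y, \<lambda>x. l *s y x) \<in> L)"

text \<open>\<open>ker_pow L l k\<close> is $\ker (L-l)^k$, with the natural domain of the power.\<close>

primrec ker_pow ::
  "((real \<Rightarrow> complex^2) \<times> (real \<Rightarrow> complex^2)) set \<Rightarrow> complex \<Rightarrow> nat
    \<Rightarrow> (real \<Rightarrow> complex^2) set" where
  "ker_pow L l 0 = {y \<in> L2. eq01 y (\<lambda>_. 0)}"
| "ker_pow L l (Suc k) = {y. \<exists>f. (y, f) \<in> L \<and> (\<lambda>x. f x - l *s y x) \<in> ker_pow L l k}"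

definition root_subspace ::
  "((real \<Rightarrow> complex^2) \<times> (real \<Rightarrow> complex^2)) set \<Rightarrow> complex \<Rightarrow> (real \<Rightarrow> complex^2) set" where
  "root_subspace L l = L2_span (\<Union>k. ker_pow L l k)"

text \<open>
  The bases of the root subspaces are not unique, so this is a predicate on \<open>S\<close>. They are
  algebraic bases, hence exist also when a root subspace is infinite-dimensional.
\<close>

definition root_function_system ::
  "((real \<Rightarrow> complex^2) \<times> (real \<Rightarrow> complex^2)) set \<Rightarrow> (real \<Rightarrow> complex^2) set \<Rightarrow> bool" where
  "root_function_system L S \<longleftrightarrow>
     (\<exists>bas. (\<forall>l. is_eigenvalue L l \<longrightarrow> L2_basis (bas l) (root_subspace L l)) \<and>
            S = (\<Union>l\<in>{l. is_eigenvalue L l}. bas l))"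

definition J :: "complex^4^2 \<Rightarrow> 4 \<Rightarrow> 4 \<Rightarrow> complex" where
  "J a j k = det (vector [vector [a$1$j, a$1$k], vector [a$2$j, a$2$k]] :: complex^2^2)"

text \<open>The closed essential support in $[0,1]$.\<close>

definition ess_supp :: "(real \<Rightarrow> complex) \<Rightarrow> real set" where
  "ess_supp f =
     {x \<in> {0..1}. \<forall>U. open U \<and> x \<in> U \<longrightarrow> \<not> (AE t in M01. t \<in> U \<longrightarrow> f t = 0)}"

end

theory Submission
  imports Defs
begin

text \<open>
  The assumptions on the minors decouple the boundary conditions into $y_1(0) = s\,y_2(1)$ and
  $y_2(0) = r\,y_1(1)$ with $s = -J_{43}/J_{13}$, $r = -J_{13}/J_{12}$, and $J_{12}J_{43} = J_{13}J_{42}$.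
  Since $P_1 = P_2 = 0$ near $0$, the reflected function $(s\,y_2(1-x), r\,y_1(1-x))$ satisfies the same
  differential equation as $y$ on some interval $[0,\varepsilon]$, with the same initial data. By
  uniqueness for linear systems and induction on the height, every root function satisfies
  $y_1(x) = s\,y_2(1-x)$, $y_2(x) = r\,y_1(1-x)$ on $[0,\varepsilon]$. For each
  $I \subseteq [0,\varepsilon]$ the function $(1_I(x), -\overline{s}\,1_I(1-x))$ is therefore orthogonal to
  all root functions, and a sequence of disjoint intervals $I$ gives infinite defect.
\<close>

section \<open>Reflection of the unit interval\<close>

lemma measurable_reflect_M01 [measurable]: "(\<lambda>x::real. 1 - x) \<in> M01 \<rightarrow>\<^sub>M M01"
proof -
  have eq: "(\<lambda>x. 1 + - 1 * x) = (\<lambda>x::real. 1 - x)" by auto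
  have mL: "(\<lambda>x::real. 1 - x) \<in> lebesgue \<rightarrow>\<^sub>M lebesgue"
    using lebesgue_affine_measurable[of "\<lambda>_::real. -1" 1] by (simp add: eq)
  show ?thesis
    by (rule measurable_restrict_space3[OF mL]) auto
qed

text \<open>The reflection has slope of modulus one and maps [0,1] onto itself, so the invariance of
  Lebesgue measure passes to the restriction. The transfers of a.e. statements and of Lebesgue
  integrals to reflected arguments rest on this.\<close>

lemma distr_M01_reflect: "distr M01 M01 (\<lambda>x. 1 - x) = M01"
proof -
  have eq: "(\<lambda>x. 1 + - 1 * x) = (\<lambda>x::real. 1 - x)" by auto
  have D: "distr lebesgue lebesgue (\<lambda>x::real. 1 - x) = lebesgue"
    using lebesgue_real_affine[of "-1" 1] unfolding eq by (simp add: density_1)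
  have mL: "(\<lambda>x::real. 1 - x) \<in> lebesgue \<rightarrow>\<^sub>M lebesgue"
    using lebesgue_affine_measurable[of "\<lambda>_::real. -1" 1] by (simp add: eq)
  show ?thesis
  proof (rule measure_eqI)
    fix A assume "A \<in> sets (distr M01 M01 (\<lambda>x. 1 - x))"
    then have A: "A \<in> sets lebesgue" "A \<subseteq> {0..1}"
      by (auto simp: sets_restrict_space_iff)
    have "emeasure (distr M01 M01 (\<lambda>x. 1 - x)) A = emeasure M01 ((\<lambda>x. 1 - x) -` A \<inter> space M01)"
      using A by (intro emeasure_distr[OF measurable_reflect_M01]) (auto simp: sets_restrict_space_iff)
    also have "(\<lambda>x. 1 - x) -` A \<inter> space M01 = (\<lambda>x. 1 - x) -` A \<inter> space lebesgue"
      using A by (fastforce simp: space_restrict_space)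
    also have "emeasure M01 \<dots> = emeasure lebesgue \<dots>"
      using A by (subst emeasure_restrict_space) auto
    also have "\<dots> = emeasure (distr lebesgue lebesgue (\<lambda>x::real. 1 - x)) A"
      by (rule emeasure_distr[OF mL A(1), symmetric])
    also have "\<dots> = emeasure M01 A"
      unfolding D using A by (simp add: emeasure_restrict_space)
    finally show "emeasure (distr M01 M01 (\<lambda>x. 1 - x)) A = emeasure M01 A" .
  qed simp
qed

lemma AE_reflect:
  assumes "AE x in M01. P x" shows "AE x in M01. P (1 - x)"
  by (rule AE_distrD[OF measurable_reflect_M01]) (subst distr_M01_reflect, rule assms)

lemma integral_reflect_M01:
  fixes f :: "real \<Rightarrow> 'a::{banach, second_countable_topology}"
  assumes "f \<in> borel_measurable M01"
  shows "(LINT x|M01. f (1 - x)) = (LINT x|M01. f x)"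
  using integral_distr[OF measurable_reflect_M01 assms] unfolding distr_M01_reflect by (rule sym)

lemma integrable_reflect_M01:
  fixes f :: "real \<Rightarrow> 'a::{banach, second_countable_topology}"
  assumes "integrable M01 f" shows "integrable M01 (\<lambda>x. f (1 - x))"
  by (rule integrable_distr[OF measurable_reflect_M01]) (subst distr_M01_reflect, rule assms)

text \<open>Substitution gives an integral over [1 - x, 1]. Its form as a difference of integrals
  starting at 0 matches the representation of \<open>u\<close> in \<open>W12_deriv\<close>.\<close>

lemma integral_reflect_initial:
  fixes f :: "real \<Rightarrow> 'a::banach"
  assumes "f integrable_on {0..1}" and x: "x \<in> {0..1}"
  shows "integral {0..x} (\<lambda>t. f (1 - t)) = integral {0..1} f - integral {0..1 - x} f"
proof -
  have "f integrable_on {1 - x..1}"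
    using assms by (auto intro: integrable_subinterval_real)
  then have "(f has_integral integral {1 - x..1} f) (cbox (1 - x) 1)"
    by (simp add: integrable_integral)
  from has_integral_affinity[OF this, of "-1" 1]
  have "((\<lambda>t. f (1 - t)) has_integral integral {1 - x..1} f) ((\<lambda>t. 1 - t) ` {1 - x..1})"
    by simp
  moreover have "(\<lambda>t. 1 - t) ` {1 - x..1} = {0..x}" by simp
  ultimately have "integral {0..x} (\<lambda>t. f (1 - t)) = integral {1 - x..1} f"
    by (simp add: integral_unique)
  with Henstock_Kurzweil_Integration.integral_combine[of 0 "1 - x" 1 f] assms show ?thesis
    by (auto simp: algebra_simps)
qed

lemma absolutely_integrable_on_lebesgue_on:
  fixes f :: "'a::euclidean_space \<Rightarrow> 'b::euclidean_space"
  assumes "T \<in> sets lebesgue"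
  shows "f absolutely_integrable_on T \<longleftrightarrow> integrable (lebesgue_on T) f"
  using assms by (simp add: set_integrable_def integrable_restrict_space)

section \<open>A Gronwall-type lemma\<close>

text \<open>The kernel \<open>k\<close> is only integrable, as are coefficients built from a
  square-integrable potential. Smallness therefore comes from its primitive, not from a bound on
  \<open>k\<close>.\<close>

lemma gronwall_zero:
  fixes d k :: "real \<Rightarrow> real"
  assumes d: "continuous_on {0..e} d" and d0: "\<And>x. x \<in> {0..e} \<Longrightarrow> 0 \<le> d x"
    and k: "k absolutely_integrable_on {0..e}" and k0: "\<And>x. x \<in> {0..e} \<Longrightarrow> 0 \<le> k x"
    and le: "\<And>x. x \<in> {0..e} \<Longrightarrow> d x \<le> integral {0..x} (\<lambda>t. k t * d t)"
    and x: "x \<in> {0..e}"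
  shows "d x = 0"
proof -
  have "(\<lambda>t. d t * k t) absolutely_integrable_on {0..e}"
    by (intro absolutely_integrable_bounded_measurable_product_real
        continuous_imp_measurable_on_sets_lebesgue d k compact_imp_bounded
        compact_continuous_image) auto
  then have kd: "(\<lambda>t. k t * d t) integrable_on {0..e}"
    by (simp add: mult.commute set_lebesgue_integral_eq_integral(1))
  have ki: "k integrable_on {0..e}"
    using k by (simp add: set_lebesgue_integral_eq_integral(1))
  txt \<open>On steps of length at most \<open>\<eta>/2\<close> the integral of \<open>k\<close> is below \<open>1/2\<close>, so the maximum of \<open>d\<close> over a step
    is at most half of itself.\<close>
  have "uniformly_continuous_on {0..e} (\<lambda>x. integral {0..x} k)"
    by (intro compact_uniformly_continuous indefinite_integral_continuous_1 ki) auto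
  then obtain \<eta> where \<eta>: "\<eta> > 0" and
    uc: "\<And>x y. \<lbrakk>x \<in> {0..e}; y \<in> {0..e}; dist y x < \<eta>\<rbrakk> \<Longrightarrow>
           dist (integral {0..y} k) (integral {0..x} k) < 1/2"
    unfolding uniformly_continuous_on_def by (metis half_gt_zero zero_less_one)
  have step: "\<forall>x\<in>{0..e}. x \<le> real n * (\<eta>/2) \<longrightarrow> d x = 0" for n
  proof (induction n)
    case 0
    have "d 0 = 0" if "0 \<le> e" using le[of 0] d0[of 0] that by simp
    then show ?case by auto
  next
    case (Suc n)
    show ?case
    proof (intro ballI impI)
      fix x assume x: "x \<in> {0..e}" "x \<le> real (Suc n) * (\<eta>/2)"
      define c where "c = real n * (\<eta>/2)"
      have c0: "0 \<le> c" using \<eta> by (simp add: c_def)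
      have xc: "x \<le> c + \<eta>/2" using x by (simp add: c_def algebra_simps)
      \<comment> \<open>The maximum is taken over all of \<open>{0..x}\<close>, so
        \<open>d z\<close> bounds \<open>d\<close> on \<open>{c..z}\<close> and also at
        \<open>x\<close>.\<close>
      obtain z where z: "z \<in> {0..x}" "\<And>t. t \<in> {0..x} \<Longrightarrow> d t \<le> d z"
        using continuous_attains_sup[of "{0..x}" d] x continuous_on_subset[OF d, of "{0..x}"]
        by auto
      have ze: "z \<in> {0..e}" using z x by auto
      have "d z = 0"
      proof (cases "z \<le> c")
        case True
        then show ?thesis using Suc.IH ze by (simp add: c_def)
      next
        case False
        then have cz: "c \<in> {0..e}" "c < z" using c0 ze by auto
        have "k t * d t = 0" if "t \<in> {0..c}" for t
          using Suc.IH cz that by (auto simp: c_def)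
        then have "integral {0..c} (\<lambda>t. k t * d t) = integral {0..c} (\<lambda>_. 0)"
          by (rule Henstock_Kurzweil_Integration.integral_cong)
        then have I1: "integral {0..c} (\<lambda>t. k t * d t) = 0" by simp
        have kI: "k integrable_on {c..z}" "(\<lambda>t. k t * d t) integrable_on {c..z}"
          using cz ze by (auto intro: integrable_subinterval_real[OF ki] integrable_subinterval_real[OF kd])
        have "d z \<le> integral {0..c} (\<lambda>t. k t * d t) + integral {c..z} (\<lambda>t. k t * d t)"
          using le[OF ze] cz ze
          by (subst Henstock_Kurzweil_Integration.integral_combine)
            (auto intro: integrable_subinterval_real[OF kd])
        also have "\<dots> = integral {c..z} (\<lambda>t. k t * d t)" using I1 by simp
        also have "\<dots> \<le> integral {c..z} (\<lambda>t. k t * d z)"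
          using cz ze z(2) z(1) x k0 c0
          by (intro integral_le kI integrable_on_mult_left) (auto intro!: mult_left_mono)
        also have "\<dots> = integral {c..z} k * d z" by simp
        also have "integral {c..z} k = integral {0..z} k - integral {0..c} k"
          using Henstock_Kurzweil_Integration.integral_combine[of 0 c z k] cz ze
            integrable_subinterval_real[OF ki, of 0 z] by auto
        also have "(integral {0..z} k - integral {0..c} k) * d z \<le> (1/2) * d z"
        proof (intro mult_right_mono d0[OF ze])
          \<comment> \<open>Half steps make this strict: \<open>z\<close> exceeds \<open>c\<close>
            by at most \<open>\<eta>/2\<close>.\<close>
          have "dist z c < \<eta>" using cz z(1) xc \<eta> by (simp add: dist_real_def)
          then show "integral {0..z} k - integral {0..c} k \<le> 1/2"
            using uc[OF cz(1) ze] unfolding dist_real_def by linarith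
        qed
        finally show ?thesis using d0[OF ze] by simp
      qed
      then show "d x = 0" using z(2)[of x] x d0[of x] by force
    qed
  qed
  obtain n where "x / (\<eta>/2) \<le> real n" using real_arch_simple by blast
  then show ?thesis using step[of n] x \<eta> by (auto simp: field_simps)
qed

section \<open>The reflection symmetry near 0\<close>

text \<open>Under \<open>M01\<close> the bound \<open>x \<le> e\<close> confines \<open>x\<close> to
  \<open>{0..e}\<close> when \<open>e \<le> 1\<close>. The a.e. form makes the relation independent
  of the representative of \<open>y\<close>.\<close>

definition symmetric_near_0 :: "real \<Rightarrow> complex \<Rightarrow> complex \<Rightarrow> (real \<Rightarrow> complex^2) \<Rightarrow> bool" where
  "symmetric_near_0 e s r y \<longleftrightarrow>
     (AE x in M01. x \<le> e \<longrightarrow> y x $ 1 = s * y (1 - x) $ 2 \<and> y x $ 2 = r * y (1 - x) $ 1)"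

lemma symmetric_near_0_cong:
  assumes "eq01 y z" "symmetric_near_0 e s r z"
  shows "symmetric_near_0 e s r y"
proof -
  have E: "AE x in M01. y x = z x" using assms(1) by (simp add: eq01_def)
  \<comment> \<open>The relation evaluates \<open>y\<close> at \<open>x\<close> and at
    \<open>1 - x\<close>, so the exceptional null set is discarded together with its
    reflection.\<close>
  show ?thesis
    using E AE_reflect[OF E] assms(2) unfolding symmetric_near_0_def by eventually_elim simp
qed

lemma symmetric_near_0_sum:
  assumes "finite F" "\<And>f. f \<in> F \<Longrightarrow> symmetric_near_0 e s r f"
  shows "symmetric_near_0 e s r (lin_comb F c)"
proof -
  have "AE x in M01. \<forall>f\<in>F. x \<le> e \<longrightarrow> f x $ 1 = s * f (1 - x) $ 2 \<and> f x $ 2 = r * f (1 - x) $ 1"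
    using assms unfolding symmetric_near_0_def by (intro AE_finite_allI) auto
  then show ?thesis
    unfolding symmetric_near_0_def
    by eventually_elim (auto simp: lin_comb_def sum_distrib_left mult.left_commute intro!: sum.cong)
qed

lemma symmetric_near_0_span:
  assumes "\<And>f. f \<in> V \<Longrightarrow> symmetric_near_0 e s r f" "y \<in> L2_span V"
  shows "symmetric_near_0 e s r y"
  using assms symmetric_near_0_cong symmetric_near_0_sum unfolding L2_span_def by blast

section \<open>Componentwise integral representation of Sobolev functions\<close>

lemma finite_measure_M01: "finite_measure M01"
  by (rule finite_measure_lebesgue_on) simp

lemma L2_integrable: 
  assumes "f \<in> L2" shows "integrable M01 f"
proof -
  interpret finite_measure M01 by (rule finite_measure_M01)
  have [measurable]: "f \<in> borel_measurable M01" using assms by (simp add: L2_def)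
  have "integrable M01 (\<lambda>x. norm (f x))"
    by (rule square_integrable_imp_integrable) (use assms in \<open>auto simp: L2_def\<close>)
  then show ?thesis by (simp add: integrable_norm_iff)
qed

lemma integrable_vec_nth:
  fixes f :: "'b \<Rightarrow> 'a::euclidean_space ^ 'n"
  assumes "integrable M f" shows "integrable M (\<lambda>x. f x $ i)"
  by (rule integrable_bounded_linear[OF bounded_linear_vec_nth assms])

text \<open>Taking a component is a bounded linear map and commutes with the Bochner integral. The
  result is phrased with gauge integrals, for which subintervals and substitutions are handled
  below.\<close>

lemma W12_deriv_nth:
  assumes "W12_deriv u g"
  shows "(\<lambda>t. g t $ j) absolutely_integrable_on {0..1}"
    and "x \<in> {0..1} \<Longrightarrow> u x $ j = u 0 $ j + integral {0..x} (\<lambda>t. g t $ j)"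
proof -
  have g: "integrable M01 g" using assms by (simp add: W12_deriv_def L2_integrable)
  then show "(\<lambda>t. g t $ j) absolutely_integrable_on {0..1}"
    by (simp add: absolutely_integrable_on_lebesgue_on integrable_vec_nth)
  assume x: "x \<in> {0..1}"
  have gx: "integrable (lebesgue_on {0..x}) g"
    using g by (rule integrable_subinterval) (use x in auto)
  have "u x = u 0 + (LINT t|lebesgue_on {0..x}. g t)"
    using assms x unfolding W12_deriv_def by blast
  then have "u x $ j = u 0 $ j + (LINT t|lebesgue_on {0..x}. g t) $ j" by simp
  also have "(LINT t|lebesgue_on {0..x}. g t) $ j = (LINT t|lebesgue_on {0..x}. g t $ j)"
    by (rule integral_bounded_linear[OF bounded_linear_vec_nth gx, symmetric])
  also have "\<dots> = integral {0..x} (\<lambda>t. g t $ j)"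
    by (intro lebesgue_integral_eq_integral integrable_vec_nth gx) auto
  finally show "u x $ j = u 0 $ j + integral {0..x} (\<lambda>t. g t $ j)" .
qed

lemma continuous_on_W12:
  assumes "W12_deriv u g" shows "continuous_on {0..1} (\<lambda>x. u x $ j)"
proof -
  have "continuous_on {0..1} (\<lambda>x. u 0 $ j + integral {0..x} (\<lambda>t. g t $ j))"
    using W12_deriv_nth(1)[OF assms, of j]
    by (intro continuous_intros indefinite_integral_continuous_1) (simp add: set_lebesgue_integral_eq_integral(1))
  then show ?thesis
    by (rule continuous_on_eq) (rule W12_deriv_nth(2)[OF assms, symmetric])
qed

section \<open>Symmetry of solutions of the differential equation\<close>

text \<open>Reflection flips the sign of the derivative, hence the plus sign in the integrand. The
  boundary condition says that the difference vanishes at 0, so no constant term remains.\<close>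

lemma integral_reflected_difference:
  assumes W: "W12_deriv u g" and bc: "u 0 $ i = s * u 1 $ j" and x: "x \<in> {0..1}"
  shows "u x $ i - s * u (1 - x) $ j = integral {0..x} (\<lambda>t. g t $ i + s * g (1 - t) $ j)"
proof -
  have gi: "(\<lambda>t. g t $ i) integrable_on {0..1}" for i
    using W12_deriv_nth(1)[OF W, of i] by (simp add: set_lebesgue_integral_eq_integral(1))
  have "integrable M01 (\<lambda>t. g (1 - t) $ j)"
    using W by (intro integrable_reflect_M01[where f = "\<lambda>t. g t $ j"] integrable_vec_nth)
      (simp add: W12_deriv_def L2_integrable)
  then have gr: "(\<lambda>t. g (1 - t) $ j) integrable_on {0..1}"
    by (simp add: integrable_on_lebesgue_on)
  have "integral {0..x} (\<lambda>t. g t $ i + s * g (1 - t) $ j)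
      = integral {0..x} (\<lambda>t. g t $ i) + s * integral {0..x} (\<lambda>t. g (1 - t) $ j)"
    using x by (subst Henstock_Kurzweil_Integration.integral_add)
      (auto intro!: integrable_on_mult_right integrable_subinterval_real[OF gi] integrable_subinterval_real[OF gr])
  also have "integral {0..x} (\<lambda>t. g (1 - t) $ j)
      = integral {0..1} (\<lambda>t. g t $ j) - integral {0..1 - x} (\<lambda>t. g t $ j)"
    by (rule integral_reflect_initial[OF gi x])
  also have "\<dots> = u 1 $ j - u (1 - x) $ j"
    using W12_deriv_nth(2)[OF W, of 1 j] W12_deriv_nth(2)[OF W, of "1 - x" j] x by simp
  also have "integral {0..x} (\<lambda>t. g t $ i) = u x $ i - u 0 $ i"
    using W12_deriv_nth(2)[OF W, of x i] x by simp
  finally show ?thesis by (simp add: bc algebra_simps)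
qed

text \<open>Uniqueness for a homogeneous Volterra system. With \<open>d\<close> and \<open>k\<close>
  the sums of the norms of unknowns and coefficients, each of the two integrals is bounded by the
  integral of \<open>k t * d t\<close>; adding them gives the kernel \<open>2 * k t\<close> for
  \<open>gronwall_zero\<close>.\<close>

lemma linear_system_zero:
  fixes d1 d2 p1 p2 q1 q2 :: "real \<Rightarrow> complex"
  assumes cont: "continuous_on {0..e} d1" "continuous_on {0..e} d2"
    and int: "p1 absolutely_integrable_on {0..e}" "p2 absolutely_integrable_on {0..e}"
      "q1 absolutely_integrable_on {0..e}" "q2 absolutely_integrable_on {0..e}"
    and d1: "\<And>x. x \<in> {0..e} \<Longrightarrow> d1 x = integral {0..x} (\<lambda>t. p1 t * d1 t + p2 t * d2 t)"
    and d2: "\<And>x. x \<in> {0..e} \<Longrightarrow> d2 x = integral {0..x} (\<lambda>t. q1 t * d1 t + q2 t * d2 t)"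
    and x: "x \<in> {0..e}"
  shows "d1 x = 0 \<and> d2 x = 0"
proof -
  define d where "d = (\<lambda>x. norm (d1 x) + norm (d2 x))"
  define k where "k = (\<lambda>x. norm (p1 x) + norm (p2 x) + norm (q1 x) + norm (q2 x))"
  \<comment> \<open>The type is left general because the fact serves both the complex terms of the
    system and the real product of \<open>k\<close> and \<open>d\<close>.\<close>
  have prod: "(\<lambda>t. c t * f t) integrable_on {0..y}"
    if "continuous_on {0..e} f" "c absolutely_integrable_on {0..e}" "y \<le> e"
    for c f :: "real \<Rightarrow> 'a::{euclidean_space,real_normed_field}" and y
  proof -
    have "(\<lambda>t. f t * c t) absolutely_integrable_on {0..e}"
      by (intro absolutely_integrable_bounded_measurable_product[OF bilinear_times]
        continuous_imp_measurable_on_sets_lebesgue that compact_imp_bounded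
        compact_continuous_image) auto
    then have "(\<lambda>t. c t * f t) integrable_on {0..e}"
      by (simp add: mult.commute set_lebesgue_integral_eq_integral(1))
    then show ?thesis
      by (rule integrable_subinterval_real) (use that in auto)
  qed
  have cd: "continuous_on {0..e} d" unfolding d_def by (intro continuous_intros cont)
  have ki: "k absolutely_integrable_on {0..e}"
    unfolding k_def
    by (intro set_integral_add int[THEN absolutely_integrable_norm, unfolded comp_def])
  have le: "d y \<le> integral {0..y} (\<lambda>t. (2 * k t) * d t)" if y: "y \<in> {0..e}" for y
  proof -
    have kd: "(\<lambda>t. k t * d t) integrable_on {0..y}"
      using y by (intro prod cd ki) auto
    have "norm (integral {0..y} (\<lambda>t. p1 t * d1 t + p2 t * d2 t)) \<le> integral {0..y} (\<lambda>t. k t * d t)"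
    proof (rule integral_norm_bound_integral[OF _ kd])
      show "(\<lambda>t. p1 t * d1 t + p2 t * d2 t) integrable_on {0..y}"
        using y by (intro integrable_add prod cont int) auto
      show "norm (p1 t * d1 t + p2 t * d2 t) \<le> k t * d t" for t
        by (rule norm_triangle_le) (auto simp: k_def d_def norm_mult algebra_simps)
    qed
    moreover have "norm (integral {0..y} (\<lambda>t. q1 t * d1 t + q2 t * d2 t)) \<le> integral {0..y} (\<lambda>t. k t * d t)"
    proof (rule integral_norm_bound_integral[OF _ kd])
      show "(\<lambda>t. q1 t * d1 t + q2 t * d2 t) integrable_on {0..y}"
        using y by (intro integrable_add prod cont int) auto
      show "norm (q1 t * d1 t + q2 t * d2 t) \<le> k t * d t" for t
        by (rule norm_triangle_le) (auto simp: k_def d_def norm_mult algebra_simps)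
    qed
    ultimately show ?thesis
      using d1[OF y] d2[OF y] by (simp add: d_def mult.assoc)
  qed
  have "d x = 0"
  proof (rule gronwall_zero[OF cd _ _ _ le x])
    show "(\<lambda>t. 2 * k t) absolutely_integrable_on {0..e}"
      by (intro set_integrable_mult_right) (rule ki)
  qed (simp_all add: d_def k_def)
  then show ?thesis by (simp add: d_def add_nonneg_eq_0_iff)
qed

lemma integral_cong_AE_M01:
  fixes f g :: "real \<Rightarrow> 'a::banach"
  assumes "AE t in M01. t \<le> e \<longrightarrow> f t = g t" "e \<le> 1" "x \<in> {0..e}"
  shows "integral {0..x} f = integral {0..x} g"
proof -
  have "AE t in lebesgue. t \<in> {0..1} \<longrightarrow> t \<le> e \<longrightarrow> f t = g t"
    using assms(1) by (subst (asm) AE_restrict_space_iff) auto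
  then obtain N where N: "N \<in> null_sets lebesgue" "{t. \<not> (t \<in> {0..1} \<longrightarrow> t \<le> e \<longrightarrow> f t = g t)} \<subseteq> N"
    by (auto simp: eventually_ae_filter)
  show ?thesis
    by (rule integral_spike[of N]) (use N assms in \<open>auto simp: negligible_iff_null_sets\<close>)
qed

text \<open>The differences \<open>d1\<close> and \<open>d2\<close> of \<open>u\<close> and its
  reflected counterpart solve a homogeneous linear system with zero initial data. The term
  \<open>h\<close> stands for the image of the solution under L - \<open>l\<close>, that is, the
  function one level lower in a root chain; \<open>rel\<close> is the vanishing of P1 and P2 in
  rescaled form.\<close>

lemma dirac_solution_symmetric:
  assumes W: "W12_deriv u g" and e: "e \<le> 1"
    and bc: "u 0 $ 1 = s * u 1 $ 2" "u 0 $ 2 = r * u 1 $ 1"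
    and q: "integrable M01 q12" "integrable M01 q21"
    and eq: "AE x in M01. \<i> * g x $ 1 + q12 x * u x $ 2 = l * u x $ 1 + h x $ 1 \<and>
                         - \<i> * g x $ 2 + q21 x * u x $ 1 = l * u x $ 2 + h x $ 2"
    and h: "symmetric_near_0 e s r h"
    and rel: "AE x in M01. x \<le> e \<longrightarrow> r * q12 x = s * q21 (1 - x) \<and> r * q12 (1 - x) = s * q21 x"
    and x: "x \<in> {0..e}"
  shows "u x $ 1 = s * u (1 - x) $ 2 \<and> u x $ 2 = r * u (1 - x) $ 1"
proof -
  define d1 where "d1 = (\<lambda>x. u x $ 1 - s * u (1 - x) $ 2)"
  define d2 where "d2 = (\<lambda>x. u x $ 2 - r * u (1 - x) $ 1)"
  have cu: "continuous_on {0..e} (\<lambda>x. u x $ j)" for j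
    by (rule continuous_on_subset[OF continuous_on_W12[OF W]]) (use e in auto)
  have cr: "continuous_on {0..e} (\<lambda>x. u (1 - x) $ j)" for j
    by (rule continuous_on_compose2[OF continuous_on_W12[OF W, of j]])
      (use e in \<open>auto intro!: continuous_intros\<close>)
  have ai: "f absolutely_integrable_on {0..e}" if "integrable M01 f" for f :: "real \<Rightarrow> complex"
    by (rule set_integrable_subset[of _ "{0..1}"])
      (use that e in \<open>auto simp: absolutely_integrable_on_lebesgue_on\<close>)
  have solve1: "z = - \<i> * (c - w)" if "\<i> * z + w = c" for z w c :: complex
    using that by (auto simp: algebra_simps)
  have solve2: "z = \<i> * (c - w)" if "- \<i> * z + w = c" for z w c :: complex
    using that by (auto simp: algebra_simps)
  \<comment> \<open>The equation is used at \<open>t\<close> and at \<open>1 - t\<close>. The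
    symmetry of \<open>h\<close> cancels the inhomogeneous terms, and \<open>rel\<close> replaces
    the reflected potential by the potential at \<open>t\<close>.\<close>
  have key: "AE t in M01. t \<le> e \<longrightarrow>
      g t $ 1 + s * g (1 - t) $ 2 = (- \<i> * l) * d1 t + (\<i> * q12 t) * d2 t \<and>
      g t $ 2 + r * g (1 - t) $ 1 = (- \<i> * q21 t) * d1 t + (\<i> * l) * d2 t"
    using eq AE_reflect[OF eq] rel h unfolding symmetric_near_0_def
  proof eventually_elim
    case (elim t)
    show ?case
    proof (intro impI conjI)
      assume t: "t \<le> e"
      have g1: "g t $ 1 = - \<i> * (l * u t $ 1 + h t $ 1 - q12 t * u t $ 2)"
        and g2: "g t $ 2 = \<i> * (l * u t $ 2 + h t $ 2 - q21 t * u t $ 1)"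
        and g1': "g (1 - t) $ 1 = - \<i> * (l * u (1 - t) $ 1 + h (1 - t) $ 1 - q12 (1 - t) * u (1 - t) $ 2)"
        and g2': "g (1 - t) $ 2 = \<i> * (l * u (1 - t) $ 2 + h (1 - t) $ 2 - q21 (1 - t) * u (1 - t) $ 1)"
        using elim(1,2) by (blast intro: solve1 solve2)+
      have r1: "s * q21 (1 - t) = r * q12 t" and r2: "r * q12 (1 - t) = s * q21 t"
        using elim(3) t by auto
      have h1: "h t $ 1 = s * h (1 - t) $ 2" and h2: "h t $ 2 = r * h (1 - t) $ 1"
        using elim(4) t by auto
      \<comment> \<open>With the reflected potential term rewritten at \<open>t\<close>, the two
        terms containing \<open>q12 t\<close> combine to \<open>\<i> * q12 t * d2 t\<close>.\<close>
      have "s * q21 (1 - t) * u (1 - t) $ 1 = r * q12 t * u (1 - t) $ 1" using r1 by simp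
      then show "g t $ 1 + s * g (1 - t) $ 2 = (- \<i> * l) * d1 t + (\<i> * q12 t) * d2 t"
        unfolding g1 g2' h1 d1_def d2_def by algebra
      have "r * q12 (1 - t) * u (1 - t) $ 2 = s * q21 t * u (1 - t) $ 2" using r2 by simp
      then show "g t $ 2 + r * g (1 - t) $ 1 = (- \<i> * q21 t) * d1 t + (\<i> * l) * d2 t"
        unfolding g2 g1' h2 d1_def d2_def by algebra
    qed
  qed
  have key1: "AE t in M01. t \<le> e \<longrightarrow>
      g t $ 1 + s * g (1 - t) $ 2 = (- \<i> * l) * d1 t + (\<i> * q12 t) * d2 t"
    using key by eventually_elim blast
  have key2: "AE t in M01. t \<le> e \<longrightarrow>
      g t $ 2 + r * g (1 - t) $ 1 = (- \<i> * q21 t) * d1 t + (\<i> * l) * d2 t"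
    using key by eventually_elim blast
  have "d1 x = 0 \<and> d2 x = 0"
  proof (rule linear_system_zero[where ?p1.0 = "\<lambda>_. - \<i> * l" and ?p2.0 = "\<lambda>t. \<i> * q12 t"
        and ?q1.0 = "\<lambda>t. - \<i> * q21 t" and ?q2.0 = "\<lambda>_. \<i> * l", OF _ _ _ _ _ _ _ _ x])
    show "continuous_on {0..e} d1" "continuous_on {0..e} d2"
      unfolding d1_def d2_def by (intro continuous_intros cu cr)+
    show "(\<lambda>_. - \<i> * l) absolutely_integrable_on {0..e}" "(\<lambda>_. \<i> * l) absolutely_integrable_on {0..e}"
      by (intro absolutely_integrable_on_const; simp)+
    show "(\<lambda>t. \<i> * q12 t) absolutely_integrable_on {0..e}" "(\<lambda>t. - \<i> * q21 t) absolutely_integrable_on {0..e}"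
      by (intro ai integrable_mult_right q)+
    fix y assume y: "y \<in> {0..e}"
    then have y1: "y \<in> {0..1}" using e by auto
    \<comment> \<open>Only the value at \<open>y\<close> is unfolded; the occurrences under the
      integral keep the form in which \<open>key1\<close> states them.\<close>
    show "d1 y = integral {0..y} (\<lambda>t. (- \<i> * l) * d1 t + (\<i> * q12 t) * d2 t)"
      unfolding d1_def[THEN fun_cong, of y] integral_reflected_difference[OF W bc(1) y1]
      by (rule integral_cong_AE_M01[OF key1 e y])
    show "d2 y = integral {0..y} (\<lambda>t. (- \<i> * q21 t) * d1 t + (\<i> * l) * d2 t)"
      unfolding d2_def[THEN fun_cong, of y] integral_reflected_difference[OF W bc(2) y1]
      by (rule integral_cong_AE_M01[OF key2 e y])
  qed
  then show ?thesis by (simp add: d1_def d2_def)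
qed

section \<open>From solutions to root functions\<close>

text \<open>Induction on the height: level zero contains only functions vanishing a.e., and the
  first assumption lifts the symmetry by one level.\<close>

lemma ker_pow_symmetric:
  assumes "\<And>y f. (y, f) \<in> L \<Longrightarrow> symmetric_near_0 e s r (\<lambda>x. f x - l *s y x) \<Longrightarrow>
                   symmetric_near_0 e s r y"
    and "y \<in> ker_pow L l k"
  shows "symmetric_near_0 e s r y"
  using assms(2)
proof (induction k arbitrary: y)
  case 0
  have "symmetric_near_0 e s r (\<lambda>_. 0)" by (simp add: symmetric_near_0_def)
  with 0 show ?case by (auto intro: symmetric_near_0_cong)
next
  case (Suc k)
  then show ?case using assms(1) by auto
qed

text \<open>Every choice of bases is covered, because a basis lies in its root subspace and the
  symmetry passes from the kernels to their span.\<close>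

lemma root_function_symmetric:
  assumes "\<And>l y f. (y, f) \<in> L \<Longrightarrow> symmetric_near_0 e s r (\<lambda>x. f x - l *s y x) \<Longrightarrow>
                   symmetric_near_0 e s r y"
    and "root_function_system L S" "f \<in> S"
  shows "symmetric_near_0 e s r f"
proof -
  obtain l where "f \<in> root_subspace L l"
    using assms(2,3) unfolding root_function_system_def L2_basis_def by auto
  then show ?thesis
    unfolding root_subspace_def
    by (rule symmetric_near_0_span[rotated]) (use assms(1) in \<open>auto intro: ker_pow_symmetric\<close>)
qed

section \<open>Decoupling the boundary conditions\<close>

lemma boundary_conditions_decoupled:
  assumes "J a 1 4 = 0" "J a 3 2 = 0" "J a 1 3 * J a 4 2 \<noteq> 0" and u: "boundary_conditions a u"
  shows "u 0 $ 1 = - (J a 4 3 / J a 1 3) * u 1 $ 2" "u 0 $ 2 = - (J a 1 3 / J a 1 2) * u 1 $ 1"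
    and "J a 1 2 * J a 4 3 = J a 1 3 * J a 4 2"
proof -
  have J: "J a j k = a$1$j * a$2$k - a$1$k * a$2$j" for j k
    by (simp add: J_def det_2)
  \<comment> \<open>This is the Pluecker relation between the 2 by 2 minors with the term containing
    \<open>J a 1 4\<close> removed. It forces \<open>J a 1 2\<close> to be nonzero, so the quotients
    make sense.\<close>
  show P: "J a 1 2 * J a 4 3 = J a 1 3 * J a 4 2"
    using assms(1,2) unfolding J by algebra
  then have nz: "J a 1 3 \<noteq> 0" "J a 1 2 \<noteq> 0" using assms(3) by auto
  have b: "a$1$1 * u 0 $ 1 + a$1$2 * u 0 $ 2 + a$1$3 * u 1 $ 1 + a$1$4 * u 1 $ 2 = 0"
    "a$2$1 * u 0 $ 1 + a$2$2 * u 0 $ 2 + a$2$3 * u 1 $ 1 + a$2$4 * u 1 $ 2 = 0"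
    using u unfolding boundary_conditions_def by auto
  \<comment> \<open>Eliminating \<open>u 1 $ 1\<close> from the two rows leaves
    \<open>u 0 $ 2\<close> with coefficient \<open>J a 2 3\<close>, which is
    \<open>- J a 3 2 = 0\<close>.\<close>
  have "J a 1 3 * u 0 $ 1 + J a 4 3 * u 1 $ 2 = 0"
    using b assms(2) unfolding J by algebra
  then show "u 0 $ 1 = - (J a 4 3 / J a 1 3) * u 1 $ 2" using nz by (simp add: field_simps eq_neg_iff_add_eq_0)
  \<comment> \<open>Eliminating \<open>u 0 $ 1\<close> leaves \<open>u 1 $ 2\<close> with
    coefficient \<open>J a 1 4 = 0\<close>.\<close>
  have "J a 1 2 * u 0 $ 2 + J a 1 3 * u 1 $ 1 = 0"
    using b assms(1) unfolding J by algebra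
  then show "u 0 $ 2 = - (J a 1 3 / J a 1 2) * u 1 $ 1" using nz by (simp add: field_simps eq_neg_iff_add_eq_0)
qed

section \<open>Test functions orthogonal to symmetric functions\<close>

text \<open>The conjugate of \<open>s\<close> appears because \<open>L2_inner\<close> conjugates its
  second argument, where the symmetric function will stand.\<close>

definition test_fun :: "complex \<Rightarrow> real set \<Rightarrow> real \<Rightarrow> complex^2" where
  "test_fun s I = (\<lambda>x. indicator I x *\<^sub>R axis 1 1 + indicator I (1 - x) *\<^sub>R axis 2 (- cnj s))"

lemma test_fun_nth [simp]:
  "test_fun s I x $ 1 = indicator I x" "test_fun s I x $ 2 = - cnj s * indicator I (1 - x)"
  by (auto simp: test_fun_def axis_def indicator_def)

lemma norm_axis: "norm (axis i x :: 'a::real_normed_vector ^ 'n) = norm x"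
proof -
  have "(\<Sum>j\<in>UNIV. (norm (axis i x $ j :: 'a))\<^sup>2) = (\<Sum>j\<in>(UNIV :: 'n set). if j = i then (norm x)\<^sup>2 else 0)"
    by (intro sum.cong) (auto simp: axis_def)
  then show ?thesis by (simp add: norm_vec_def L2_set_def)
qed

lemma norm_test_fun: "norm (test_fun s I x) \<le> 1 + cmod s"
  unfolding test_fun_def
  by (rule norm_triangle_le, rule add_mono) (auto simp: indicator_def norm_axis)

lemma indicator_measurable_M01:
  assumes "I \<in> sets borel"
  shows "(\<lambda>x. indicator I x :: 'a::{real_normed_vector,zero_neq_one}) \<in> borel_measurable M01"
    "(\<lambda>x. indicator I (1 - x) :: 'a) \<in> borel_measurable M01"
proof -
  show 1: "(\<lambda>x. indicator I x :: 'a) \<in> borel_measurable M01"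
    using assms by (intro measurable_restrict_space1 borel_measurable_indicator) auto
  show "(\<lambda>x. indicator I (1 - x) :: 'a) \<in> borel_measurable M01"
    by (rule measurable_compose[OF measurable_reflect_M01 1])
qed

lemma test_fun_L2:
  assumes "I \<in> sets borel" shows "test_fun s I \<in> L2"
proof -
  interpret finite_measure M01 by (rule finite_measure_M01)
  have [measurable]: "test_fun s I \<in> borel_measurable M01"
    unfolding test_fun_def using indicator_measurable_M01[OF assms] by measurable
  have "integrable M01 (\<lambda>x. (norm (test_fun s I x))\<^sup>2)"
    by (rule integrable_const_bound[where B = "(1 + cmod s)\<^sup>2"])
      (auto intro!: power_mono norm_test_fun)
  then show ?thesis by (simp add: L2_def)
qed

lemma integrable_test_mult:
  fixes f :: "real \<Rightarrow> complex^2"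
  assumes I: "I \<in> sets borel" and f: "integrable M01 f"
  shows "integrable M01 (\<lambda>x. indicator I x * cnj (f x $ j))"
    and "integrable M01 (\<lambda>x. indicator I (1 - x) * cnj (f x $ j))"
proof -
  have "integrable M01 (\<lambda>x. cnj (f x $ j))"
    by (intro integrable_cnj integrable_vec_nth f)
  note this[THEN borel_measurable_integrable, measurable] indicator_measurable_M01[OF I, measurable]
  show "integrable M01 (\<lambda>x. indicator I x * cnj (f x $ j))"
  proof (rule Bochner_Integration.integrable_bound[OF \<open>integrable M01 (\<lambda>x. cnj (f x $ j))\<close>])
    show "(\<lambda>x. indicator I x * cnj (f x $ j)) \<in> borel_measurable M01" by measurable
  qed (simp add: indicator_def)
  show "integrable M01 (\<lambda>x. indicator I (1 - x) * cnj (f x $ j))"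
  proof (rule Bochner_Integration.integrable_bound[OF \<open>integrable M01 (\<lambda>x. cnj (f x $ j))\<close>])
    show "(\<lambda>x. indicator I (1 - x) * cnj (f x $ j)) \<in> borel_measurable M01" by measurable
  qed (simp add: indicator_def)
qed

lemma L2_inner_test_fun:
  assumes I: "I \<in> sets borel" and f: "integrable M01 f"
  shows "integrable M01 (\<lambda>x. \<Sum>j\<in>UNIV. test_fun s I x $ j * cnj (f x $ j))"
    and "L2_inner (test_fun s I) f
           = (LINT x|M01. indicator I x * cnj (f x $ 1) - cnj s * (indicator I (1 - x) * cnj (f x $ 2)))"
  using integrable_test_mult[OF assms] by (simp_all add: L2_inner_def sum_2 mult.assoc)

text \<open>Reflecting the integral of the second component moves it onto \<open>I\<close>, inside
  the range of the symmetry, where it cancels the integral of the first component.\<close>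

lemma test_fun_orthogonal:
  assumes I: "I \<in> sets borel" "I \<subseteq> {..e}" and f: "integrable M01 f"
    and sym: "symmetric_near_0 e s r f"
  shows "L2_inner (test_fun s I) f = 0"
proof -
  note int = integrable_test_mult[OF I(1) f]
  have "integrable M01 (\<lambda>x. f (1 - x))" by (rule integrable_reflect_M01[OF f])
  note int' = integrable_test_mult(1)[OF I(1) this]
  have "L2_inner (test_fun s I) f
      = (LINT x|M01. indicator I x * cnj (f x $ 1)) - cnj s * (LINT x|M01. indicator I (1 - x) * cnj (f x $ 2))"
    using int by (simp add: L2_inner_test_fun[OF I(1) f])
  also have "(LINT x|M01. indicator I (1 - x) * cnj (f x $ 2)) = (LINT x|M01. indicator I x * cnj (f (1 - x) $ 2))"
    using integral_reflect_M01[OF borel_measurable_integrable[OF int(2)[of 2]]] by simp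
  also have "(LINT x|M01. indicator I x * cnj (f x $ 1)) = (LINT x|M01. cnj s * (indicator I x * cnj (f (1 - x) $ 2)))"
  proof (rule integral_cong_AE)
    show "AE x in M01. indicator I x * cnj (f x $ 1) = cnj s * (indicator I x * cnj (f (1 - x) $ 2))"
      using sym unfolding symmetric_near_0_def
      by eventually_elim (use I(2) in \<open>auto simp: indicator_def\<close>)
  qed (use int int' in \<open>auto intro: borel_measurable_integrable\<close>)
  finally show ?thesis by simp
qed

text \<open>Since [0,1] has measure one, it suffices to integrate the pointwise bound n \<le>
  \<delta>/2 + n*n/(2\<delta>), which is (n - \<delta>)(n - \<delta>) \<ge> 0 rearranged. This takes
  the place of the Cauchy-Schwarz inequality.\<close>

lemma L1_le_of_L2_norm_less:
  assumes "h \<in> L2" "L2_norm h < \<delta>"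
  shows "(LINT x|M01. norm (h x)) \<le> \<delta>"
proof -
  interpret finite_measure M01 by (rule finite_measure_M01)
  have h: "integrable M01 (\<lambda>x. (norm (h x))\<^sup>2)" using assms by (simp add: L2_def)
  have "0 \<le> L2_norm h" by (simp add: L2_norm_def)
  then have d: "\<delta> > 0" using assms by simp
  have "(LINT x|M01. (norm (h x))\<^sup>2) = (L2_norm h)\<^sup>2" by (simp add: L2_norm_def)
  also have "\<dots> \<le> \<delta>\<^sup>2" using assms \<open>0 \<le> L2_norm h\<close> by (intro power_mono) auto
  finally have N: "(LINT x|M01. (norm (h x))\<^sup>2) \<le> \<delta>\<^sup>2" .
  have "(LINT x|M01. norm (h x)) \<le> (LINT x|M01. \<delta>/2 + (norm (h x))\<^sup>2 / (2 * \<delta>))"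
  proof (rule integral_mono)
    show "norm (h x) \<le> \<delta>/2 + (norm (h x))\<^sup>2 / (2 * \<delta>)" for x
    proof -
      have "0 \<le> (norm (h x) - \<delta>)\<^sup>2" by simp
      then show ?thesis using d by (simp add: field_simps power2_eq_square)
    qed
  qed (use h L2_integrable[OF assms(1)] in auto)
  also have "\<dots> = \<delta>/2 + (LINT x|M01. (norm (h x))\<^sup>2) / (2 * \<delta>)"
    using h by (simp add: measure_restrict_space)
  also have "\<dots> \<le> \<delta>/2 + \<delta>\<^sup>2 / (2 * \<delta>)"
    using N d by (intro add_left_mono divide_right_mono) auto
  also have "\<dots> = \<delta>" using d by (simp add: power2_eq_square)
  finally show ?thesis .
qed

lemma L2_diff:
  assumes f: "f \<in> L2" and g: "g \<in> L2" shows "(\<lambda>x. g x - f x) \<in> L2"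
proof -
  have [measurable]: "f \<in> borel_measurable M01" "g \<in> borel_measurable M01"
    using assms by (auto simp: L2_def)
  have "integrable M01 (\<lambda>x. 2 * (norm (f x))\<^sup>2 + 2 * (norm (g x))\<^sup>2)"
    using assms by (auto simp: L2_def)
  then have "integrable M01 (\<lambda>x. (norm (g x - f x))\<^sup>2)"
  proof (rule Bochner_Integration.integrable_bound)
    have "(norm (g x - f x))\<^sup>2 \<le> 2 * (norm (f x))\<^sup>2 + 2 * (norm (g x))\<^sup>2" for x
    proof -
      have "(norm (g x - f x))\<^sup>2 \<le> (norm (g x) + norm (f x))\<^sup>2"
        by (intro power_mono norm_triangle_ineq4) auto
      also have "\<dots> \<le> 2 * (norm (f x))\<^sup>2 + 2 * (norm (g x))\<^sup>2"
        using zero_le_power2[of "norm (g x) - norm (f x)"]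
        by (simp add: power2_eq_square algebra_simps)
      finally show ?thesis .
    qed
    then show "AE x in M01. norm ((norm (g x - f x))\<^sup>2) \<le> norm (2 * (norm (f x))\<^sup>2 + 2 * (norm (g x))\<^sup>2)"
      by simp
  qed measurable
  then show ?thesis by (simp add: L2_def)
qed

text \<open>A test function has components bounded by 1 and \<open>cmod s\<close>, so pairing with
  it is continuous for the L1 norm, hence for the L2 norm. Approximating \<open>g\<close> from
  \<open>A\<close> bounds the pairing by arbitrarily small numbers.\<close>

lemma test_fun_orthogonal_closure:
  assumes I: "I \<in> sets borel" and A: "\<And>f. f \<in> A \<Longrightarrow> f \<in> L2 \<and> L2_inner (test_fun s I) f = 0"
    and g: "g \<in> L2_closure A"
  shows "L2_inner (test_fun s I) g = 0"
proof -
  have gL: "g \<in> L2" using g by (simp add: L2_closure_def)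
  have bound: "cmod (L2_inner (test_fun s I) g) \<le> (1 + cmod s) * \<delta>" if \<delta>: "\<delta> > 0" for \<delta>
  proof -
    obtain f where f: "f \<in> A" "L2_norm (\<lambda>x. g x - f x) < \<delta>"
      using g \<delta> by (auto simp: L2_closure_def)
    have fL: "f \<in> L2" "L2_inner (test_fun s I) f = 0" using A f by auto
    define h where "h = (\<lambda>x. g x - f x)"
    have hL: "h \<in> L2" unfolding h_def by (rule L2_diff[OF fL(1) gL])
    have gi: "integrable M01 g" and fi: "integrable M01 f" and hi: "integrable M01 h"
      using L2_integrable gL fL(1) hL by auto
    have "L2_inner (test_fun s I) h = L2_inner (test_fun s I) g - L2_inner (test_fun s I) f"
      unfolding L2_inner_def h_def
      by (subst Bochner_Integration.integral_diff[OF
            L2_inner_test_fun(1)[OF I gi] L2_inner_test_fun(1)[OF I fi], symmetric])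
        (simp add: sum_subtractf[symmetric] right_diff_distrib)
    then have "cmod (L2_inner (test_fun s I) g) = cmod (L2_inner (test_fun s I) h)"
      using fL by simp
    also have "\<dots> \<le> (LINT x|M01. cmod (\<Sum>j\<in>UNIV. test_fun s I x $ j * cnj (h x $ j)))"
      unfolding L2_inner_def by (rule integral_norm_bound)
    also have "\<dots> \<le> (LINT x|M01. (1 + cmod s) * norm (h x))"
    proof (rule integral_mono)
      show "integrable M01 (\<lambda>x. cmod (\<Sum>j\<in>UNIV. test_fun s I x $ j * cnj (h x $ j)))"
        by (intro integrable_norm L2_inner_test_fun(1)[OF I hi])
      show "integrable M01 (\<lambda>x. (1 + cmod s) * norm (h x))"
        by (intro integrable_mult_right integrable_norm hi)
      fix x
      have "cmod (\<Sum>j\<in>UNIV. test_fun s I x $ j * cnj (h x $ j))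
          \<le> 1 * cmod (h x $ 1) + cmod s * cmod (h x $ 2)"
        unfolding sum_2 by (rule norm_triangle_le, rule add_mono)
          (auto simp: norm_mult indicator_def)
      also have "\<dots> \<le> 1 * norm (h x) + cmod s * norm (h x)"
        by (intro add_mono mult_left_mono component_le_norm_cart Finite_Cartesian_Product.norm_nth_le) auto
      finally show "cmod (\<Sum>j\<in>UNIV. test_fun s I x $ j * cnj (h x $ j)) \<le> (1 + cmod s) * norm (h x)"
        by (simp add: algebra_simps)
    qed
    also have "\<dots> = (1 + cmod s) * (LINT x|M01. norm (h x))" by simp
    also have "\<dots> \<le> (1 + cmod s) * \<delta>"
      using L1_le_of_L2_norm_less[OF hL] f(2) by (intro mult_left_mono) (auto simp: h_def)
    finally show ?thesis .
  qed
  have "cmod (L2_inner (test_fun s I) g) \<le> 0 + \<epsilon>" if "\<epsilon> > 0" for \<epsilon>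
  proof -
    have p: "1 + cmod s > 0" by (simp add: add_pos_nonneg)
    show ?thesis using bound[of "\<epsilon> / (1 + cmod s)"] that p by simp
  qed
  then have "cmod (L2_inner (test_fun s I) g) \<le> 0" by (rule field_le_epsilon)
  then show ?thesis by simp
qed

section \<open>Independence and infinite dimension\<close>

text \<open>On \<open>I n\<close> the first components of all other test functions vanish, so the
  first component of a combination equals a single coefficient there. As \<open>I n\<close> is not a
  null set, a nonzero coefficient contradicts a.e. vanishing.\<close>

lemma L2_indep_test_fun:
  fixes I :: "nat \<Rightarrow> real set"
  assumes I: "\<And>n. I n \<in> sets lebesgue" "\<And>n. I n \<subseteq> {0..1}" "\<And>n. I n \<notin> null_sets lebesgue"
    and disj: "disjoint_family I"
  shows "L2_indep (test_fun s ` I ` UNIV)"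
  unfolding L2_indep_def
proof (intro allI impI ballI)
  fix F c f
  assume F: "finite F \<and> F \<subseteq> test_fun s ` range I \<and> eq01 (lin_comb F c) (\<lambda>_. 0)" and f: "f \<in> F"
  then obtain n where n: "f = test_fun s (I n)" by auto
  show "c f = 0"
  proof (rule ccontr)
    assume nz: "c f \<noteq> 0"
    have val: "lin_comb F c x $ 1 = c f" if x: "x \<in> I n" for x
    proof -
      have "lin_comb F c x $ 1 = (\<Sum>g\<in>F. c g * g x $ 1)" by (simp add: lin_comb_def)
      also have "\<dots> = (\<Sum>g\<in>F. if g = f then c f else 0)"
      proof (rule sum.cong)
        fix g assume "g \<in> F"
        then obtain m where m: "g = test_fun s (I m)" using F by auto
        show "c g * g x $ 1 = (if g = f then c f else 0)"
        proof (cases "g = f")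
          case True
          then show ?thesis using x by (simp add: n)
        next
          case False
          then have "m \<noteq> n" using m n by auto
          then have "x \<notin> I m" using disj x by (auto simp: disjoint_family_on_def)
          then show ?thesis using False by (simp add: m)
        qed
      qed simp
      also have "\<dots> = c f" using F f by simp
      finally show ?thesis .
    qed
    have "AE x in M01. lin_comb F c x = 0" using F by (simp add: eq01_def)
    then have "AE x in M01. x \<notin> I n"
      by eventually_elim (use val nz in force)
    then have "AE x in lebesgue. x \<notin> I n"
      by (subst (asm) AE_restrict_space_iff) (use I(2)[of n] in \<open>auto elim!: eventually_mono\<close>)
    then show False using AE_iff_null_sets[OF I(1)] I(3) by blast
  qed
qed

lemma L2_dim_infinite:
  assumes "infinite T" "T \<subseteq> V" "L2_indep T"
  shows "L2_dim V = \<infinity>"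
proof -
  have "enat n \<le> L2_dim V" for n
  proof -
    obtain F where F: "finite F" "card F = n" "F \<subseteq> T"
      using infinite_arbitrarily_large[OF assms(1)] by blast
    then have "L2_indep F" using assms(3) unfolding L2_indep_def by blast
    then show ?thesis
      unfolding L2_dim_def using F assms(2) by (intro Sup_upper) blast
  qed
  then show ?thesis
    by (metis enat_ord_simps(1) not_infinity_eq Suc_n_not_le_n)
qed

section \<open>Localization at 0 and application to the operator\<close>

lemma not_ess_supp_0:
  assumes "0 \<notin> ess_supp f"
  obtains e where "e > 0" "AE t in M01. t \<le> e \<longrightarrow> f t = 0"
proof -
  obtain U where U: "open U" "0 \<in> U" "AE t in M01. t \<in> U \<longrightarrow> f t = 0"
    using assms by (auto simp: ess_supp_def)
  then obtain d where d: "d > 0" "ball 0 d \<subseteq> U" by (meson openE)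
  \<comment> \<open>Halving the radius puts the closed interval \<open>{0..d/2}\<close> inside the
    open ball.\<close>
  have "AE t in M01. t \<le> d/2 \<longrightarrow> f t = 0"
    using U(3) AE_space
  proof eventually_elim
    case (elim t)
    then have "t \<le> d/2 \<Longrightarrow> t \<in> ball 0 d" using d by (auto simp: space_restrict_space)
    then show ?case using elim d by blast
  qed
  then show thesis using that[of "d/2"] d by simp
qed

text \<open>This supplies, for every \<open>l\<close>, the one-level lifting required by
  \<open>root_function_symmetric\<close>.\<close>

lemma dirac_op_symmetric:
  fixes a :: "complex^4^2" and Q12 Q21 :: "real \<Rightarrow> complex"
  defines "B \<equiv> vector [vector [-1, 0], vector [0, 1]] :: complex^2^2"
    and "Q \<equiv> (\<lambda>x. vector [vector [0, Q12 x], vector [Q21 x, 0]] :: complex^2^2)"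
    and "s \<equiv> - (J a 4 3 / J a 1 3)" and "r \<equiv> - (J a 1 3 / J a 1 2)"
  assumes J: "J a 1 4 = 0" "J a 3 2 = 0" "J a 1 3 * J a 4 2 \<noteq> 0"
    and e: "e \<le> 1" and QL: "Q \<in> L2"
    and P1: "AE x in M01. x \<le> e \<longrightarrow> J a 1 3 * Q12 x - J a 4 2 * Q21 (1 - x) = 0"
    and P2: "AE x in M01. x \<le> e \<longrightarrow> J a 1 3 * Q12 (1 - x) - J a 4 2 * Q21 x = 0"
    and yf: "(y, f) \<in> dirac_op B Q a"
    and sym: "symmetric_near_0 e s r (\<lambda>x. f x - l *s y x)"
  shows "symmetric_near_0 e s r y"
proof -
  obtain u g where yu: "eq01 y u" and W: "W12_deriv u g" and bc: "boundary_conditions a u"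
    and fu: "eq01 f (\<lambda>x. (- \<i>) *s (B *v g x) + Q x *v u x)"
    using yf unfolding dirac_op_def by auto
  note d = boundary_conditions_decoupled[OF J bc]
  have nz: "J a 1 3 \<noteq> 0" "J a 1 2 \<noteq> 0" using d(3) J(3) by auto
  have "integrable M01 (\<lambda>x. Q x $ i $ j)" for i j
    by (intro integrable_vec_nth L2_integrable QL)
  from this[of 1 2] this[of 2 1] have q: "integrable M01 Q12" "integrable M01 Q21"
    by (simp_all add: Q_def)
  \<comment> \<open>Multiplying the assumption by \<open>J a 1 3\<close> and replacing
    \<open>J a 1 3 * J a 4 2\<close> by \<open>J a 1 2 * J a 4 3\<close> gives the claim after
    division by \<open>J a 1 3 * J a 1 2\<close>.\<close>
  have rel: "r * p = s * q" if "J a 1 3 * p - J a 4 2 * q = 0" for p q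
  proof -
    have "J a 1 3 * (J a 1 3 * p) = J a 1 2 * J a 4 3 * q" using that d(3) by (simp add: mult.assoc)
    then show ?thesis using nz by (simp add: r_def s_def field_simps)
  qed
  have "AE x in M01. \<i> * g x $ 1 + Q12 x * u x $ 2 = l * u x $ 1 + (f x - l *s y x) $ 1 \<and>
                     - \<i> * g x $ 2 + Q21 x * u x $ 1 = l * u x $ 2 + (f x - l *s y x) $ 2"
    using yu fu unfolding eq01_def
    by eventually_elim (simp add: B_def Q_def matrix_vector_mult_def sum_2)
  moreover have "AE x in M01. x \<le> e \<longrightarrow> r * Q12 x = s * Q21 (1 - x) \<and> r * Q12 (1 - x) = s * Q21 x"
    using P1 P2 by eventually_elim (use rel in blast)
  \<comment> \<open>For the continuous representative \<open>u\<close> the symmetry holds at every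
    point; it becomes an a.e. statement only on returning to \<open>y\<close>.\<close>
  ultimately have "u x $ 1 = s * u (1 - x) $ 2 \<and> u x $ 2 = r * u (1 - x) $ 1" if "x \<in> {0..e}" for x
    using dirac_solution_symmetric[OF W e _ _ q _ sym] d(1,2) that unfolding s_def r_def by blast
  then have "symmetric_near_0 e s r u"
    unfolding symmetric_near_0_def by (intro AE_I2) (auto simp: space_restrict_space)
  with yu show ?thesis by (rule symmetric_near_0_cong)
qed

section \<open>Infinite defect\<close>

theorem proposition5p13:
  fixes a :: "complex^4^2"
    and B :: "complex^2^2"
    and Q :: "real \<Rightarrow> complex^2^2"
    and Q12 Q21 P1 P2 :: "real \<Rightarrow> complex"
    and S :: "(real \<Rightarrow> complex^2) set"
  assumes "B = vector [vector [-1, 0], vector [0, 1]]"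
    and "Q = (\<lambda>x. vector [vector [0, Q12 x], vector [Q21 x, 0]])"
    and "Q \<in> L2"
    and "J a 1 4 = 0" and "J a 3 2 = 0" and "J a 1 3 * J a 4 2 \<noteq> 0"
    and "P1 = (\<lambda>x. J a 1 3 * Q12 x - J a 4 2 * Q21 (1 - x))"
    and "P2 = (\<lambda>x. J a 1 3 * Q12 (1 - x) - J a 4 2 * Q21 x)"
    and "0 \<notin> ess_supp P1 \<union> ess_supp P2"
    and "root_function_system (dirac_op B Q a) S"
  shows "defect S = \<infinity>"
proof -
  have "0 \<notin> ess_supp P1" "0 \<notin> ess_supp P2" using assms(9) by auto
  then obtain e1 e2 where e12: "e1 > 0" "e2 > 0" and P1: "AE t in M01. t \<le> e1 \<longrightarrow> P1 t = 0"
    and P2: "AE t in M01. t \<le> e2 \<longrightarrow> P2 t = 0"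
    by (elim not_ess_supp_0)
  \<comment> \<open>The minimum makes both relations available on \<open>{0..e}\<close>, and the cap
    at 1 keeps this interval inside [0,1].\<close>
  define e where "e = min 1 (min e1 e2)"
  have e: "0 < e" "e \<le> 1" using e12 by (auto simp: e_def)
  define s where "s = - (J a 4 3 / J a 1 3)"
  define r where "r = - (J a 1 3 / J a 1 2)"
  have P1e: "AE x in M01. x \<le> e \<longrightarrow> J a 1 3 * Q12 x - J a 4 2 * Q21 (1 - x) = 0"
    using P1 by eventually_elim (simp add: e_def assms(7))
  have P2e: "AE x in M01. x \<le> e \<longrightarrow> J a 1 3 * Q12 (1 - x) - J a 4 2 * Q21 x = 0"
    using P2 by eventually_elim (simp add: e_def assms(8))
  have "symmetric_near_0 e s r y"
    if "(y, f) \<in> dirac_op B Q a" "symmetric_near_0 e s r (\<lambda>x. f x - l *s y x)" for l y f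
    using dirac_op_symmetric[OF assms(4-6) e(2) _ P1e P2e, of y f l] that assms(3)
    unfolding assms(1,2) s_def r_def by blast
  then have "symmetric_near_0 e s r f" if "f \<in> S" for f
    using root_function_symmetric[OF _ assms(10) that] by blast
  then have span: "symmetric_near_0 e s r f" if "f \<in> L2_span S" for f
    using symmetric_near_0_span that by blast

  \<comment> \<open>Consecutive points of the sequence e/1, e/2, e/3, ... bound the intervals, which
    gives infinitely many disjoint intervals of positive length within
    \<open>{0..e}\<close>.\<close>
  define I :: "nat \<Rightarrow> real set" where "I n = {e / real (n + 2)<..<e / real (n + 1)}" for n
  have I_sub: "I n \<subseteq> {0..e}" for n
  proof
    fix x assume "x \<in> I n"
    moreover have "0 \<le> e / real (n + 2)" "e / real (n + 1) \<le> e" using e by (auto simp: field_simps)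
    ultimately show "x \<in> {0..e}" by (auto simp: I_def)
  qed
  have I_borel: "I n \<in> sets borel" for n by (simp add: I_def)
  have I_pos: "I n \<notin> null_sets lebesgue" for n
  proof -
    have "e / real (n + 2) < e / real (n + 1)" using e by (simp add: frac_less2)
    with e show ?thesis by (simp add: I_def null_sets_def)
  qed
  have "I m \<inter> I n = {}" if "m < n" for m n
  proof -
    \<comment> \<open>From \<open>m < n\<close> follows \<open>m + 2 \<le> n + 1\<close>, so
      \<open>I n\<close> ends no later than \<open>I m\<close> begins.\<close>
    have "e / real (n + 1) \<le> e / real (m + 2)" using e that by (intro divide_left_mono) auto
    then show ?thesis by (auto simp: I_def)
  qed
  then have disj: "disjoint_family I"
    unfolding disjoint_family_on_def by (metis Int_commute linorder_neqE_nat)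
  define T where "T = test_fun s ` range I"
  have indep: "L2_indep T"
    unfolding T_def
    by (rule L2_indep_test_fun[OF _ _ I_pos disj])
      (use I_sub e in \<open>fastforce simp: I_def\<close>)+
  have orth: "T \<subseteq> L2_orth_compl (L2_closure (L2_span S))"
  proof
    fix f assume "f \<in> T"
    then obtain n where n: "f = test_fun s (I n)" by (auto simp: T_def)
    have "L2_inner (test_fun s (I n)) g = 0" if "g \<in> L2_span S" for g
      using I_borel I_sub[of n] that L2_integrable
      by (intro test_fun_orthogonal[OF _ _ _ span]) (auto simp: L2_span_def)
    then have "L2_inner (test_fun s (I n)) g = 0" if "g \<in> L2_closure (L2_span S)" for g
      using test_fun_orthogonal_closure[OF I_borel _ that] by (auto simp: L2_span_def)
    then show "f \<in> L2_orth_compl (L2_closure (L2_span S))"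
      by (simp add: n L2_orth_compl_def test_fun_L2[OF I_borel])
  qed
  \<comment> \<open>Distinct indices must give distinct functions for \<open>T\<close> to be
    infinite; the first component at a point of \<open>I m\<close> separates them.\<close>
  have "inj (\<lambda>n. test_fun s (I n))"
  proof (rule injI, rule ccontr)
    fix m n assume eq: "test_fun s (I m) = test_fun s (I n)" and ne: "m \<noteq> n"
    have "I m \<noteq> {}" using I_pos[of m] by auto
    then obtain x where x: "x \<in> I m" by auto
    then have "x \<notin> I n" using disj ne by (auto simp: disjoint_family_on_def)
    then show False
      using x arg_cong[OF eq, of "\<lambda>f. f x $ 1"] by simp
  qed
  then have "infinite T"
    unfolding T_def image_image by (rule range_inj_infinite)
  then show ?thesis
    unfolding defect_def using orth indep by (rule L2_dim_infinite)
qed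

end
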